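(* Let $G$ be a Hausdorff topological group with identity $e$. Then $G$ is $\omega$-balanced and a strong $q$-space if and only if for each open neighborhood $O$ of $e$ in $G$ there is a closed sequentially compact invariant subgroup $H$ of $G$ which is of countable character $\{V_n:n\in\omega\}$ in $G$, such that $H\subseteq O$, $\{V_n:n\in\omega\}$ is a strong $q$-sequence in $G$ at each $y\in H$, the canonical quotient mapping $p:G\rightarrow G/H$ is strongly sequential-perfect, and the quotient group $G/H$ is metrizable.
   Context: All topological groups and spaces are assumed to be Hausdorff. "Invariant subgroup" means normal subgroup. For a subgroup $H$ of $G$, $G/H$ is the space of left cosets with the quotient topology, and $p:G\to G/H$ is the canonical quotient mapping. A topological group $G$ is $\omega$-balanced if for every neighbourhood $U$ of the identity $e$ there is a countable family $\gamma$ of open neighbourhoods of $e$ such that for each $x\in G$ there is $V\in\gamma$ with $xVx^{-1}\subseteq U$. A space is sequentially compact if every sequence in it has a convergent subsequence; a subset is sequentially compact if it is so as a subspace. A sequence $\{U_n:n\in\omega\}$ of open neighborhoods of a point $x$ in a space $X$ is a strong $q$-sequence at $x$ if every sequence $\{x_n\}_{n\in\omega}$ of points of $X$ with $x_n\in U_n$ for each $n\in\omega$ has a subsequence converging in $X$. A point $x$ is a strong $q$-point of $X$ if there is a strong $q$-sequence at $x$. A space is a strong $q$-space if each of its points is a strong $q$-point. A subset $A$ of a space $X$ is of countable character $\{V_n:n\in\omega\}$ in $X$ if $\{V_n:n\in\omega\}$ is a countable family of open neighborhoods of $A$ (open sets containing $A$) such that each open neighborhood $U$ of $A$ contains some $V_n$.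 A continuous mapping $f:X\to Y$ is strongly sequential-perfect if $f$ is closed and $f^{-1}(F)$ is a sequentially compact set for each sequentially compact set $F\subseteq Y$. *)

theory Defs
  imports "HOL-Analysis.Analysis" "HOL-Algebra.Left_Coset"
begin

locale topological_group = group G for G (structure) +
  fixes T :: "'a topology"
  assumes topspace_eq_carrier: "topspace T = carrier G"
    and continuous_mult: "continuous_map (prod_topology T T) T (\<lambda>(x, y). x \<otimes> y)"
    and continuous_inv: "continuous_map T T (\<lambda>x. inv x)"

text \<open>A neighbourhood of the identity is any set having the identity in its interior.\<close>

definition omega_balanced :: "('a, 'b) monoid_scheme \<Rightarrow> 'a topology \<Rightarrow> bool" where
  "omega_balanced G T \<longleftrightarrow>
     (\<forall>U \<subseteq> topspace T. \<one>\<^bsub>G\<^esub> \<in> T interior_of U \<longrightarrow>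
        (\<exists>\<gamma>. countable \<gamma> \<and> (\<forall>V\<in>\<gamma>. openin T V \<and> \<one>\<^bsub>G\<^esub> \<in> V) \<and>
             (\<forall>x\<in>carrier G. \<exists>V\<in>\<gamma>. (\<lambda>v. x \<otimes>\<^bsub>G\<^esub> v \<otimes>\<^bsub>G\<^esub> inv\<^bsub>G\<^esub> x) ` V \<subseteq> U)))"

definition sequentially_compact_space :: "'a topology \<Rightarrow> bool" where
  "sequentially_compact_space X \<longleftrightarrow>
     (\<forall>s :: nat \<Rightarrow> 'a. (\<forall>n. s n \<in> topspace X) \<longrightarrow>
        (\<exists>l r. strict_mono r \<and> limitin X (s \<circ> r) l sequentially))"

definition sequentially_compactin :: "'a topology \<Rightarrow> 'a set \<Rightarrow> bool" where
  "sequentially_compactin X S \<longleftrightarrow>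
     S \<subseteq> topspace X \<and> sequentially_compact_space (subtopology X S)"

text \<open>The subsequence has to converge in the space, not necessarily to the base point.\<close>

definition strong_q_sequence :: "'a topology \<Rightarrow> (nat \<Rightarrow> 'a set) \<Rightarrow> 'a \<Rightarrow> bool" where
  "strong_q_sequence X U x \<longleftrightarrow>
     (\<forall>n. openin X (U n) \<and> x \<in> U n) \<and>
     (\<forall>s. (\<forall>n. s n \<in> U n) \<longrightarrow>
        (\<exists>l r. strict_mono r \<and> limitin X (s \<circ> r) l sequentially))"

definition strong_q_point :: "'a topology \<Rightarrow> 'a \<Rightarrow> bool" where
  "strong_q_point X x \<longleftrightarrow> (\<exists>U. strong_q_sequence X U x)"

definition strong_q_space :: "'a topology \<Rightarrow> bool" where
  "strong_q_space X \<longleftrightarrow> (\<forall>x\<in>topspace X. strong_q_point X x)"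

definition countable_character :: "'a topology \<Rightarrow> 'a set \<Rightarrow> (nat \<Rightarrow> 'a set) \<Rightarrow> bool" where
  "countable_character X A V \<longleftrightarrow>
     (\<forall>n. openin X (V n) \<and> A \<subseteq> V n) \<and>
     (\<forall>U. openin X U \<and> A \<subseteq> U \<longrightarrow> (\<exists>n. V n \<subseteq> U))"

definition strongly_sequential_perfect_map ::
    "'a topology \<Rightarrow> 'b topology \<Rightarrow> ('a \<Rightarrow> 'b) \<Rightarrow> bool" where
  "strongly_sequential_perfect_map X Y f \<longleftrightarrow>
     continuous_map X Y f \<and> closed_map X Y f \<and>
     (\<forall>F. sequentially_compactin Y F \<longrightarrow>
        sequentially_compactin X {x \<in> topspace X. f x \<in> F})"

definition quotient_topology :: "'a topology \<Rightarrow> ('a \<Rightarrow> 'b) \<Rightarrow> 'b topology" where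
  "quotient_topology X f =
     topology (\<lambda>U. U \<subseteq> f ` topspace X \<and> openin X {x \<in> topspace X. f x \<in> U})"

lemma openin_quotient_topology:
  "openin (quotient_topology X f) U \<longleftrightarrow>
     U \<subseteq> f ` topspace X \<and> openin X {x \<in> topspace X. f x \<in> U}"
proof -
  have "istopology (\<lambda>U. U \<subseteq> f ` topspace X \<and> openin X {x \<in> topspace X. f x \<in> U})"
    unfolding istopology_def
  proof (intro conjI allI impI)
    fix S T
    assume S: "S \<subseteq> f ` topspace X \<and> openin X {x \<in> topspace X. f x \<in> S}"
      and T: "T \<subseteq> f ` topspace X \<and> openin X {x \<in> topspace X. f x \<in> T}"
    show "S \<inter> T \<subseteq> f ` topspace X" using S by blast
    have "{x \<in> topspace X. f x \<in> S \<inter> T} =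
        {x \<in> topspace X. f x \<in> S} \<inter> {x \<in> topspace X. f x \<in> T}" by blast
    then show "openin X {x \<in> topspace X. f x \<in> S \<inter> T}" using S T by auto
  next
    fix K
    assume K: "\<forall>S\<in>K. S \<subseteq> f ` topspace X \<and> openin X {x \<in> topspace X. f x \<in> S}"
    show "\<Union>K \<subseteq> f ` topspace X" using K by blast
    have "{x \<in> topspace X. f x \<in> \<Union>K} = (\<Union>S\<in>K. {x \<in> topspace X. f x \<in> S})" by blast
    then show "openin X {x \<in> topspace X. f x \<in> \<Union>K}" using K by auto
  qed
  then show ?thesis
    by (simp add: quotient_topology_def)
qed

lemma topspace_quotient_topology [simp]:
  "topspace (quotient_topology X f) = f ` topspace X"
proof -
  have "{x \<in> topspace X. f x \<in> f ` topspace X} = topspace X" by blast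
  then have "openin (quotient_topology X f) (f ` topspace X)"
    by (simp add: openin_quotient_topology)
  then show ?thesis
    using openin_quotient_topology[of X f "topspace (quotient_topology X f)"]
    by (meson openin_subset openin_topspace subset_antisym)
qed

lemma quotient_map_quotient_topology: "quotient_map X (quotient_topology X f) f"
  by (auto simp: quotient_map_def openin_quotient_topology)

abbreviation coset_map :: "('a, 'b) monoid_scheme \<Rightarrow> 'a set \<Rightarrow> 'a \<Rightarrow> 'a set" where
  "coset_map G H \<equiv> (\<lambda>x. x <#\<^bsub>G\<^esub> H)"

definition coset_space :: "('a, 'b) monoid_scheme \<Rightarrow> 'a topology \<Rightarrow> 'a set \<Rightarrow> 'a set topology" where
  "coset_space G T H = quotient_topology T (coset_map G H)"

lemma (in topological_group) topspace_coset_space: "topspace (coset_space G T H) = lcosets H"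
  by (auto simp: coset_space_def topspace_eq_carrier LCOSETS_def)

lemma (in topological_group) topspace_coset_space_normal:
  assumes "H \<lhd> G"
  shows "topspace (coset_space G T H) = carrier (G Mod H)"
  using normal.coset_eq[OF assms]
  by (auto simp: coset_space_def topspace_eq_carrier FactGroup_def RCOSETS_def)

end

theory Submission
  imports Defs
begin

text \<open>
  Starting from a strong q-sequence at the identity, \<open>\<omega>\<close>-balancedness allows one to choose
  symmetric open neighbourhoods \<open>V\<^sub>n\<close> of the identity inside the given neighbourhood with
  \<open>V\<^sub>n\<^sub>+\<^sub>1\<^sup>3 \<subseteq> V\<^sub>n\<close> such that every conjugate of every \<open>V\<^sub>n\<close> contains some \<open>V\<^sub>m\<close>. Their
  intersection \<open>H\<close> is a closed normal subgroup. A sequence that is eventually in each \<open>V\<^sub>n\<close> has a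
  subsequence converging to a point of \<open>H\<close>, so every open set around \<open>H\<close> contains some \<open>V\<^sub>n\<close>.
  Hence the images of the \<open>V\<^sub>n\<close> form a base at the identity of the quotient, which is metrizable by
  Frink's chain argument. Conversely, if \<open>H\<close> is normal, the preimage of a neighbourhood of \<open>H\<close> under
  conjugation is again one, so a countable character of \<open>H\<close> witnesses \<open>\<omega>\<close>-balancedness.
\<close>

section \<open>Metrization by a countable base of relations\<close>

text \<open>Frink's lemma, by cutting the chain at the link where the running sum passes half of the
  total. The parts before and after that link each have sum at most half, so by induction their ends
  are within the total; the link itself is one summand. \<open>chain3\<close> then joins the three
  pieces at the cost of a single factor 2.\<close>

lemma weak_triangle_chain:
  fixes w :: "'a \<Rightarrow> 'a \<Rightarrow> real"
  assumes nonneg: "\<And>x y. 0 \<le> w x y" and refl: "\<And>x. w x x = 0"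
    and chain3: "\<And>a b c d e. \<lbrakk>w a b \<le> e; w b c \<le> e; w c d \<le> e\<rbrakk> \<Longrightarrow> w a d \<le> 2 * e"
  shows "i \<le> j \<Longrightarrow> w (f i) (f j) \<le> 2 * (\<Sum>l=i..<j. w (f l) (f (Suc l)))"
proof (induction "j - i" arbitrary: i j rule: less_induct)
  case less
  let ?S = "\<lambda>i j. \<Sum>l=i..<j. w (f l) (f (Suc l))"
  show ?case
  proof (cases "i = j")
    case True
    then show ?thesis by (simp add: refl)
  next
    case False
    with less.prems have "i < j" by simp
    have S0: "0 \<le> ?S a b" for a b by (simp add: sum_nonneg nonneg)
    \<comment> \<open>The last \<open>k\<close> here starts the crossing link; the range stops
      before \<open>j\<close> so that this link belongs to the chain.\<close>
    define A where "A = {k \<in> {i..<j}. ?S i k \<le> ?S i j / 2}"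
    have "finite A" "i \<in> A" using \<open>i < j\<close> S0[of i j] by (auto simp: A_def)
    define k where "k = Max A"
    have "k \<in> A" using \<open>finite A\<close> \<open>i \<in> A\<close> Max_in k_def by blast
    then have k: "i \<le> k" "k < j" "?S i k \<le> ?S i j / 2" by (auto simp: A_def)
    have split: "?S i j = ?S i (Suc k) + ?S (Suc k) j"
      using k sum.atLeastLessThan_concat[of i "Suc k" j "\<lambda>l. w (f l) (f (Suc l))"] by simp
    \<comment> \<open>By maximality of \<open>k\<close> the sum through the crossing link exceeds
      half of the total, unless this link is the last one and nothing remains.\<close>
    have rest: "?S (Suc k) j \<le> ?S i j / 2"
    proof (cases "Suc k < j")
      case True
      have "Suc k \<notin> A"
        using Max_ge[OF \<open>finite A\<close>, of "Suc k"] k_def by auto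
      then have "?S i (Suc k) > ?S i j / 2" using True k unfolding A_def by auto
      then show ?thesis using split by simp
    next
      case False
      then have "Suc k = j" using k by simp
      then show ?thesis using S0[of i j] by simp
    qed
    have "w (f k) (f (Suc k)) \<le> ?S i j"
      by (rule member_le_sum[where f="\<lambda>l. w (f l) (f (Suc l))"]) (use k nonneg in auto)
    moreover have "w (f i) (f k) \<le> ?S i j" using less.hyps[of k i] k by linarith
    moreover have "w (f (Suc k)) (f j) \<le> ?S i j" using less.hyps[of j "Suc k"] k rest by linarith
    ultimately show ?thesis using chain3 by blast
  qed
qed

text \<open>The metric is the infimum of the lengths of all finite chains, where a single link weighs
  about \<open>2\<^sup>-\<^sup>n\<close> if \<open>n\<close> is the last index whose relation it satisfies.\<close>

lemma pseudometric_from_relations: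
  fixes R :: "nat \<Rightarrow> 'a \<Rightarrow> 'a \<Rightarrow> bool"
  assumes R0: "\<And>x y. R 0 x y" and refl: "\<And>n x. R n x x"
    and sym: "\<And>n x y. R n x y \<Longrightarrow> R n y x"
    and chain3: "\<And>n a b c d. \<lbrakk>R (Suc n) a b; R (Suc n) b c; R (Suc n) c d\<rbrakk> \<Longrightarrow> R n a d"
  shows "\<exists>d :: 'a \<Rightarrow> 'a \<Rightarrow> real.
    (\<forall>x y. 0 \<le> d x y) \<and> (\<forall>x y. d x y = d y x) \<and> (\<forall>x. d x x = 0) \<and>
    (\<forall>x y z. d x z \<le> d x y + d y z) \<and>
    (\<forall>n x y. R n x y \<longrightarrow> d x y \<le> (1/2)^n) \<and>
    (\<forall>n x y. d x y < (1/2)^Suc n \<longrightarrow> R n x y)"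
proof -
  have R_Suc: "R n x y" if "R (Suc n) x y" for n x y using chain3[OF that refl refl] .
  have R_mono: "R m x y" if "m \<le> n" "R n x y" for m n x y
    using that by (induction rule: dec_induct) (auto intro: R_Suc)
  \<comment> \<open>The infimum \<open>w\<close> is 0 when all relations hold, and \<open>R0\<close>
    keeps the set of weights nonempty.\<close>
  define L where "L x y = (\<lambda>n. (1/2)^n :: real) ` {n. R n x y}" for x y
  define w where "w x y = Inf (L x y)" for x y
  have Lne: "L x y \<noteq> {}" for x y using R0 by (auto simp: L_def)
  have Lbdd: "bdd_below (L x y)" for x y
    by (rule bdd_belowI[where m=0]) (auto simp: L_def)
  have w0: "0 \<le> w x y" for x y
    unfolding w_def by (rule cInf_greatest[OF Lne]) (auto simp: L_def)
  have w_le: "w x y \<le> (1/2)^n" if "R n x y" for n x y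
    unfolding w_def by (rule cInf_lower[OF _ Lbdd]) (use that in \<open>auto simp: L_def\<close>)
  \<comment> \<open>All weights are powers of 1/2, so a strict inequality gains one index. This gain
    pays for the index lost in \<open>chain3\<close>.\<close>
  have w_less: "R (Suc n) x y" if less: "w x y < (1/2)^n" for n x y
  proof -
    obtain m where m: "R m x y" "(1/2::real)^m < (1/2)^n"
      using cInf_lessD[OF Lne less[unfolded w_def]] by (auto simp: L_def)
    then have "Suc n \<le> m" using power_strict_decreasing_iff[of "1/2::real" m n] by simp
    then show ?thesis using m R_mono by blast
  qed
  have small: "e \<le> 0" if "\<And>n. e \<le> (1/2)^n" for e :: real
  proof (rule ccontr)
    assume "\<not> e \<le> 0"
    then obtain n where "(1/2)^n < e" using real_arch_pow_inv[of e "1/2"] by auto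
    then show False using that[of n] by simp
  qed
  have w_refl: "w x x = 0" for x
    using small[of "w x x"] w_le[OF refl] w0[of x x] by force
  have w_sym: "w x y = w y x" for x y
    unfolding w_def L_def using sym by (metis (no_types, lifting))
  have w_chain: "w a d \<le> 2 * e" if e: "w a b \<le> e" "w b c \<le> e" "w c d \<le> e" for a b c d e
  proof (cases "e < 1")
    case False
    then show ?thesis using w_le[OF R0, of a d] by simp
  next
    case True
    have up: "w a d \<le> (1/2)^n" if "e < (1/2)^n" for n
      using e that by (intro w_le chain3[of n a b c d] w_less) auto
    show ?thesis
    proof (cases "e = 0")
      case True
      then show ?thesis using small[of "w a d"] up by simp
    next
      case False
      then have "0 < e" using e w0[of a b] by simp
      then obtain m where "(1/2::real)^m < e" using real_arch_pow_inv[of e "1/2"] by auto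
      \<comment> \<open>The least such \<open>n\<close> satisfies
        \<open>(1/2)^n \<le> e < (1/2)^(n-1)\<close>, so the bound \<open>up\<close> at
        \<open>n-1\<close> is at most \<open>2 * e\<close>. For \<open>e = 0\<close> no such
        \<open>n\<close> exists, whence the separate case.\<close>
      define n where "n = (LEAST m. (1/2::real)^m \<le> e)"
      have n: "(1/2::real)^n \<le> e"
        unfolding n_def using \<open>(1/2)^m < e\<close> by (metis (mono_tags, lifting) LeastI less_imp_le)
      then have "n \<noteq> 0" using \<open>e < 1\<close> by (cases n) auto
      then obtain k where k: "n = Suc k" using not0_implies_Suc by blast
      have "e < (1/2)^k" using not_less_Least[of k "\<lambda>m. (1/2::real)^m \<le> e"] k n_def by simp
      then have "w a d \<le> (1/2)^k" by (rule up)
      then show ?thesis using n k by simp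
    qed
  qed
  \<comment> \<open>A chain is encoded as a total sequence together with its number of links
    \<open>k\<close>; only the entries \<open>0\<close> to \<open>k\<close> count.\<close>
  define S where "S f k = (\<Sum>l<k. w (f l) (f (Suc l)))" for f :: "nat \<Rightarrow> 'a" and k :: nat
  define C where "C x y = {S f k | f k. f 0 = x \<and> f k = y}" for x y
  have S_mem: "S f k \<in> C (f 0) (f k)" for f k by (auto simp: C_def)
  \<comment> \<open>This lower bound on chain lengths prevents the infimum from collapsing:
    \<open>d\<close> stays between \<open>w / 2\<close> and \<open>w\<close>.\<close>
  have C_ge: "w x y / 2 \<le> s" if s: "s \<in> C x y" for x y s
  proof -
    obtain f k where "s = S f k" "f 0 = x" "f k = y" using s by (auto simp: C_def)
    moreover have "w (f 0) (f k) \<le> 2 * (\<Sum>l=0..<k. w (f l) (f (Suc l)))"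
      by (rule weak_triangle_chain[of w, OF w0 w_refl]) (use w_chain in blast)+
    ultimately show ?thesis by (simp add: S_def atLeast0LessThan)
  qed
  have w_mem: "w x y \<in> C x y" for x y
    using S_mem[of "\<lambda>i. if i = 0 then x else y" 1] by (simp add: S_def)
  have C_sym: "C x y \<subseteq> C y x" for x y
  proof
    fix s assume "s \<in> C x y"
    then obtain f k where f: "s = S f k" "f 0 = x" "f k = y" by (auto simp: C_def)
    have "S (\<lambda>i. f (k - i)) k = S f k"
      unfolding S_def
      by (subst sum.nat_diff_reindex[symmetric]) (auto intro!: sum.cong simp: w_sym Suc_diff_Suc)
    then show "s \<in> C y x" using S_mem[of "\<lambda>i. f (k - i)" k] f by simp
  qed
  have C_add: "s + t \<in> C x z" if st: "s \<in> C x y" "t \<in> C y z" for s t x y z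
  proof -
    obtain f k g m where f: "s = S f k" "f 0 = x" "f k = y" and g: "t = S g m" "g 0 = y" "g m = z"
      using st by (auto simp: C_def)
    \<comment> \<open>At the joint \<open>i = k\<close> the second branch applies, and
      \<open>g 0 = f k\<close> makes both chains agree there.\<close>
    define h where "h i = (if i < k then f i else g (i - k))" for i
    have fh: "h i = f i" if "i \<le> k" for i using that f g by (auto simp: h_def)
    have gh: "h (k + i) = g i" for i by (simp add: h_def)
    have "S h (k + m) = S h k + (\<Sum>l<m. w (h (k + l)) (h (k + Suc l)))"
      unfolding S_def by (induction m) auto
    also have "\<dots> = S f k + S g m" unfolding S_def gh by (simp add: fh)
    finally show ?thesis using S_mem[of h "k + m"] f g fh[of 0] gh[of m] by simp
  qed
  define d where "d x y = Inf (C x y)" for x y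
  have bdd: "bdd_below (C x y)" for x y using C_ge by (rule bdd_belowI)
  have ne: "C x y \<noteq> {}" for x y using w_mem by blast
  have d_ge: "w x y / 2 \<le> d x y" for x y unfolding d_def by (rule cInf_greatest[OF ne C_ge])
  have d_le: "d x y \<le> w x y" for x y unfolding d_def by (rule cInf_lower[OF w_mem bdd])
  have d_nonneg: "0 \<le> d x y" for x y using d_ge[of x y] w0[of x y] by simp
  have d_refl: "d x x = 0" for x using d_nonneg[of x x] d_le[of x x] w_refl[of x] by simp
  have d_sym: "d x y = d y x" for x y
    unfolding d_def using C_sym by (metis subset_antisym)
  have d_triangle: "d x z \<le> d x y + d y z" for x y z
  proof -
    have "d x z - s \<le> d y z" if s: "s \<in> C x y" for s
      unfolding d_def[of y z]
    proof (rule cInf_greatest[OF ne])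
      fix t assume "t \<in> C y z"
      then have "d x z \<le> s + t"
        unfolding d_def by (intro cInf_lower[OF _ bdd] C_add[OF s])
      then show "d x z - s \<le> t" by simp
    qed
    then have "d x z - d y z \<le> s" if "s \<in> C x y" for s
      using that by (simp add: algebra_simps)
    then have "d x z - d y z \<le> d x y"
      unfolding d_def[of x y] by (rule cInf_greatest[OF ne])
    then show ?thesis by simp
  qed
  have d_upper: "d x y \<le> (1/2)^n" if "R n x y" for n x y
    using d_le[of x y] w_le[OF that] by simp
  \<comment> \<open>Here \<open>w x y < (1/2)^n\<close>, which even yields the relation at level
    \<open>Suc n\<close>; that extra level is given up.\<close>
  have d_lower: "R n x y" if "d x y < (1/2)^Suc n" for n x y
    using d_ge[of x y] that by (intro R_Suc[OF w_less]) simp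
  show ?thesis
    using d_nonneg d_sym d_refl d_triangle d_upper d_lower by (intro exI[of _ d] conjI allI impI)
qed

text \<open>The relations are first adapted to \<open>pseudometric_from_relations\<close>, which
  concerns the whole type and a total relation at level 0. Metric balls and the sets of points
  related to \<open>x\<close> then refine each other, so \<open>openin\<close> identifies the two
  topologies.\<close>

lemma metrizable_space_from_relations:
  fixes X :: "'a topology" and R :: "nat \<Rightarrow> 'a \<Rightarrow> 'a \<Rightarrow> bool"
  defines "M \<equiv> topspace X"
  assumes refl: "\<And>n x. x \<in> M \<Longrightarrow> R n x x"
    and sym: "\<And>n x y. \<lbrakk>x \<in> M; y \<in> M; R n x y\<rbrakk> \<Longrightarrow> R n y x"
    and chain3: "\<And>n a b c d. \<lbrakk>a \<in> M; b \<in> M; c \<in> M; d \<in> M; R (Suc n) a b; R (Suc n) b c;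
        R (Suc n) c d\<rbrakk> \<Longrightarrow> R n a d"
    and separating: "\<And>x y. \<lbrakk>x \<in> M; y \<in> M; \<And>n. R n x y\<rbrakk> \<Longrightarrow> x = y"
    and openin: "\<And>U. U \<subseteq> M \<Longrightarrow> openin X U \<longleftrightarrow> (\<forall>x\<in>U. \<exists>n. \<forall>y\<in>M. R n x y \<longrightarrow> y \<in> U)"
  shows "metrizable_space X"
proof -
  \<comment> \<open>The shift by one makes room for a total relation at level 0. At positive levels,
    points outside \<open>M\<close> are related only to themselves.\<close>
  define Q where "Q n x y \<longleftrightarrow> n = 0 \<or> x = y \<or> x \<in> M \<and> y \<in> M \<and> R (n - 1) x y" for n x y
  have Q_M: "Q (Suc n) x y \<longleftrightarrow> R n x y" if "x \<in> M" "y \<in> M" for n x y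
    using that refl by (auto simp: Q_def)
  have Q_0: "Q 0 x y" for x y by (simp add: Q_def)
  have Q_refl: "Q n x x" for n x by (simp add: Q_def)
  have Q_sym: "Q n y x" if "Q n x y" for n x y using that sym by (auto simp: Q_def)
  have Q_in: "y \<in> M" if "Q (Suc n) x y" "x \<in> M" for n x y
    using that by (auto simp: Q_def)
  have Q_out: "y = x" if "Q (Suc n) x y" "x \<notin> M" for n x y
    using that by (auto simp: Q_def)
  have Q_chain: "Q n a d" if abcd: "Q (Suc n) a b" "Q (Suc n) b c" "Q (Suc n) c d" for n a b c d
  proof (cases n)
    case 0
    then show ?thesis by (simp add: Q_def)
  next
    case (Suc m)
    \<comment> \<open>A chain that starts in \<open>M\<close> stays in \<open>M\<close>, and a chain
      that starts outside is constant.\<close>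
    show ?thesis
    proof (cases "a \<in> M")
      case True
      then have "b \<in> M" "c \<in> M" "d \<in> M" using Q_in abcd by blast+
      then show ?thesis using True abcd Q_M chain3[of a b c d m] Suc by simp
    next
      case False
      then have "d = a" using Q_out abcd by metis
      then show ?thesis by (simp add: Q_def)
    qed
  qed
  obtain d :: "'a \<Rightarrow> 'a \<Rightarrow> real" where d: "\<And>x y. 0 \<le> d x y" "\<And>x y. d x y = d y x" "\<And>x. d x x = 0"
    "\<And>x y z. d x z \<le> d x y + d y z"
    "\<And>n x y. Q n x y \<Longrightarrow> d x y \<le> (1/2)^n"
    "\<And>n x y. d x y < (1/2)^Suc n \<Longrightarrow> Q n x y"
    by (atomize_elim, rule pseudometric_from_relations) (fact Q_0 Q_refl Q_sym Q_chain)+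
  \<comment> \<open>One \<open>Suc\<close> comes from the pseudometric estimate, the other from the
    shift in \<open>Q\<close>.\<close>
  have d_R: "R n x y" if "x \<in> M" "y \<in> M" "d x y < (1/2)^Suc (Suc n)" for n x y
    using d(6)[OF that(3)] Q_M that by blast
  interpret Metric_space M d
  proof
    fix x y assume xy: "x \<in> M" "y \<in> M"
    show "d x y = 0 \<longleftrightarrow> x = y"
      using d(3) d_R[OF xy] separating[OF xy] by (metis zero_less_divide_1_iff zero_less_numeral zero_less_power)
  qed (rule d(1,2,4))+
  have "openin X U \<longleftrightarrow> openin mtopology U" for U
  proof (cases "U \<subseteq> M")
    case False
    then show ?thesis using openin_subset topspace_mtopology M_def by metis
  next
    case True
    have "(\<exists>n. \<forall>y\<in>M. R n x y \<longrightarrow> y \<in> U) \<longleftrightarrow> (\<exists>r>0. mball x r \<subseteq> U)" if "x \<in> U" for x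
    proof
      assume "\<exists>n. \<forall>y\<in>M. R n x y \<longrightarrow> y \<in> U"
      then obtain n where "\<forall>y\<in>M. R n x y \<longrightarrow> y \<in> U" ..
      then have "mball x ((1/2)^Suc (Suc n)) \<subseteq> U" using d_R by (auto simp: in_mball)
      then show "\<exists>r>0. mball x r \<subseteq> U" by (metis zero_less_divide_1_iff zero_less_numeral zero_less_power)
    next
      assume "\<exists>r>0. mball x r \<subseteq> U"
      then obtain r where r: "r > 0" "mball x r \<subseteq> U" by blast
      then obtain n where n: "(1/2::real)^n < r" using real_arch_pow_inv[of r "1/2"] by auto
      have "y \<in> U" if "y \<in> M" "R n x y" for y
      proof -
        have "d x y \<le> (1/2)^Suc n" using that d(5) Q_M \<open>x \<in> U\<close> True by blast
        also have "\<dots> \<le> (1/2)^n" by simp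
        finally have "y \<in> mball x r" using that n \<open>x \<in> U\<close> True by (auto simp: in_mball)
        then show ?thesis using r by blast
      qed
      then show "\<exists>n. \<forall>y\<in>M. R n x y \<longrightarrow> y \<in> U" by blast
    qed
    then show ?thesis using openin[OF True] True by (auto simp: openin_mtopology)
  qed
  then have "X = mtopology" by (simp add: topology_eq)
  then show ?thesis using metrizable_space_mtopology by simp
qed

section \<open>Neighbourhoods in topological groups\<close>

context topological_group
begin

lemma continuous_map_mult:
  assumes "continuous_map X T f" "continuous_map X T g"
  shows "continuous_map X T (\<lambda>x. f x \<otimes> g x)"
  using continuous_map_compose[OF continuous_map_pairedI[OF assms] continuous_mult]
  by (simp only: o_def case_prod_conv)

lemma continuous_map_left_mult: "x \<in> carrier G \<Longrightarrow> continuous_map T T (\<lambda>y. x \<otimes> y)"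
  by (rule continuous_map_mult) (simp_all add: topspace_eq_carrier)

lemma continuous_map_conj:
  "x \<in> carrier G \<Longrightarrow> continuous_map T T (\<lambda>y. x \<otimes> y \<otimes> inv x)"
  by (rule continuous_map_mult[OF continuous_map_left_mult]) (simp_all add: topspace_eq_carrier)

lemma open_square_root:
  assumes "openin T U" "\<one> \<in> U"
  obtains A where "openin T A" "\<one> \<in> A" "\<And>x y. \<lbrakk>x \<in> A; y \<in> A\<rbrakk> \<Longrightarrow> x \<otimes> y \<in> U"
proof -
  let ?P = "{p \<in> topspace (prod_topology T T). (case p of (x, y) \<Rightarrow> x \<otimes> y) \<in> U}"
  have "openin (prod_topology T T) ?P"
    using openin_continuous_map_preimage[OF continuous_mult assms(1)] .
  moreover have "(\<one>, \<one>) \<in> ?P" using assms by (simp add: topspace_eq_carrier)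
  ultimately obtain A B
    where AB: "openin T A" "openin T B" "\<one> \<in> A" "\<one> \<in> B" "A \<times> B \<subseteq> ?P"
    unfolding openin_prod_topology_alt by meson
  show thesis
  proof (rule that)
    show "openin T (A \<inter> B)" using AB by blast
    show "\<one> \<in> A \<inter> B" using AB by blast
    show "x \<otimes> y \<in> U" if "x \<in> A \<inter> B" "y \<in> A \<inter> B" for x y
      using subsetD[OF AB(5), of "(x, y)"] that by simp
  qed
qed

text \<open>Two square roots are taken: \<open>x \<otimes> y\<close> lands in \<open>A\<close> for
  factors from \<open>B\<close>, and multiplying by \<open>z\<close> from \<open>A\<close> lands in
  \<open>U\<close>. Intersecting with the preimage under inversion gives symmetry.\<close>

lemma open_symmetric_cube_root:
  assumes U: "openin T U" "\<one> \<in> U"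
  obtains C where "openin T C" "\<one> \<in> C" "\<And>x. x \<in> C \<Longrightarrow> inv x \<in> C"
    "\<And>x y z. \<lbrakk>x \<in> C; y \<in> C; z \<in> C\<rbrakk> \<Longrightarrow> x \<otimes> y \<otimes> z \<in> U"
proof -
  obtain A where A: "openin T A" "\<one> \<in> A" "\<And>x y. \<lbrakk>x \<in> A; y \<in> A\<rbrakk> \<Longrightarrow> x \<otimes> y \<in> U"
    using open_square_root[OF U] by blast
  obtain B where B: "openin T B" "\<one> \<in> B" "\<And>x y. \<lbrakk>x \<in> B; y \<in> B\<rbrakk> \<Longrightarrow> x \<otimes> y \<in> A"
    using open_square_root[OF A(1,2)] by blast
  let ?D = "A \<inter> B"
  have D: "openin T ?D" "?D \<subseteq> carrier G"
    using A(1) B(1) openin_subset topspace_eq_carrier by blast+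
  let ?C = "?D \<inter> {x \<in> topspace T. inv x \<in> ?D}"
  show thesis
  proof (rule that[of ?C])
    show "openin T ?C"
      using openin_continuous_map_preimage[OF continuous_inv D(1)] D(1) by blast
    show "\<one> \<in> ?C" using A(2) B(2) by (simp add: topspace_eq_carrier)
    show "inv x \<in> ?C" if "x \<in> ?C" for x
      using that by (simp add: topspace_eq_carrier)
    show "x \<otimes> y \<otimes> z \<in> U" if "x \<in> ?C" "y \<in> ?C" "z \<in> ?C" for x y z
      using that by (intro A(3) B(3)) auto
  qed
qed

text \<open>Sequences are moved to the identity, where a subsequence converges, and the limit is
  moved back by the continuous translation. Hence a strong q-point at the identity suffices for the
  whole group.\<close>

lemma strong_q_sequence_left_translate:
  assumes V: "strong_q_sequence T V \<one>" and x: "x \<in> carrier G"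
  shows "strong_q_sequence T (\<lambda>n. {y \<in> topspace T. inv x \<otimes> y \<in> V n}) x"
  unfolding strong_q_sequence_def
proof (intro conjI allI impI)
  have V': "openin T (V n)" "\<one> \<in> V n" for n using V by (auto simp: strong_q_sequence_def)
  show "openin T {y \<in> topspace T. inv x \<otimes> y \<in> V n}" for n
    using x by (intro openin_continuous_map_preimage[OF continuous_map_left_mult] V') auto
  show "x \<in> {y \<in> topspace T. inv x \<otimes> y \<in> V n}" for n
    using x V' by (simp add: topspace_eq_carrier)
  fix s assume s: "\<forall>n. s n \<in> {y \<in> topspace T. inv x \<otimes> y \<in> V n}"
  then have "\<forall>n. inv x \<otimes> s n \<in> V n" by blast
  then obtain l r where lr: "strict_mono r" "limitin T ((\<lambda>n. inv x \<otimes> s n) \<circ> r) l sequentially"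
    using V unfolding strong_q_sequence_def by meson
  have "limitin T ((\<lambda>y. x \<otimes> y) \<circ> ((\<lambda>n. inv x \<otimes> s n) \<circ> r)) (x \<otimes> l) sequentially"
    using continuous_map_limit[OF continuous_map_left_mult[OF x] lr(2)] .
  moreover have "(\<lambda>y. x \<otimes> y) \<circ> ((\<lambda>n. inv x \<otimes> s n) \<circ> r) = s \<circ> r"
    using s x by (auto simp: fun_eq_iff topspace_eq_carrier m_assoc[symmetric])
  ultimately show "\<exists>l r. strict_mono r \<and> limitin T (s \<circ> r) l sequentially" using lr(1) by metis
qed

lemma subgroup_lcoset_eq_iff:
  assumes "subgroup H G" "x \<in> carrier G" "y \<in> carrier G"
  shows "x <# H = y <# H \<longleftrightarrow> inv x \<otimes> y \<in> H"
proof
  assume "x <# H = y <# H"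
  then have "y \<in> x <# H" using lcos_self assms by blast
  then show "inv x \<otimes> y \<in> H"
    using subgroup.lcos_module_imp[OF assms(1) group_axioms assms(2)] by blast
next
  assume "inv x \<otimes> y \<in> H"
  then have "y \<in> x <# H"
    using subgroup.lcos_module_rev[OF assms(1) group_axioms assms(2,3)] by blast
  then show "x <# H = y <# H" using l_repr_independence assms by blast
qed

lemma mult_cancel_middle:
  "\<lbrakk>x \<in> carrier G; y \<in> carrier G; z \<in> carrier G\<rbrakk> \<Longrightarrow> (x \<otimes> y) \<otimes> (inv y \<otimes> z) = x \<otimes> z"
  by (metis inv_closed inv_solve_left m_assoc m_closed)

lemma omega_balancedD:
  assumes "omega_balanced G T" "openin T U" "\<one> \<in> U"
  obtains g :: "nat \<Rightarrow> 'a set" where "\<And>n. openin T (g n)" "\<And>n. \<one> \<in> g n"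
    "\<And>x. x \<in> carrier G \<Longrightarrow> \<exists>n. \<forall>v\<in>g n. x \<otimes> v \<otimes> inv x \<in> U"
proof -
  have "U \<subseteq> topspace T" "\<one> \<in> T interior_of U"
    using assms(2,3) by (auto simp: openin_subset interior_of_openin)
  then obtain \<gamma> where \<gamma>: "countable \<gamma>" "\<forall>V\<in>\<gamma>. openin T V \<and> \<one> \<in> V"
    "\<forall>x\<in>carrier G. \<exists>V\<in>\<gamma>. (\<lambda>v. x \<otimes> v \<otimes> inv x) ` V \<subseteq> U"
    using assms(1) unfolding omega_balanced_def by meson
  \<comment> \<open>Conjugation by the identity already demands a member of \<open>\<gamma>\<close>;
    nonemptiness permits its enumeration as a sequence, possibly with repetitions.\<close>
  have "\<gamma> \<noteq> {}" using \<gamma>(3) by blast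
  then have rng: "range (from_nat_into \<gamma>) = \<gamma>" using \<gamma>(1) by (rule range_from_nat_into)
  show thesis
  proof (rule that[of "from_nat_into \<gamma>"])
    show "\<exists>n. \<forall>v\<in>from_nat_into \<gamma> n. x \<otimes> v \<otimes> inv x \<in> U" if x: "x \<in> carrier G" for x
    proof -
      obtain V where "V \<in> \<gamma>" "(\<lambda>v. x \<otimes> v \<otimes> inv x) ` V \<subseteq> U" using \<gamma>(3) x by blast
      moreover obtain n where "V = from_nat_into \<gamma> n" using rng \<open>V \<in> \<gamma>\<close> by blast
      ultimately show ?thesis by blast
    qed
  qed (use \<gamma>(2) rng in auto)
qed

end

section \<open>Conjugation-absorbing sequences of neighbourhoods\<close>

text \<open>Cubes rather than squares are required because a change of both coset representatives
  inserts a factor on either side of a product. \<open>conj_V\<close> yields normality of the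
  intersection, and \<open>convergent_V\<close> is the strong q-condition without a base
  point.\<close>

locale absorbing_q_sequence = topological_group G T for G (structure) and T +
  fixes V :: "nat \<Rightarrow> 'a set"
  assumes open_V: "openin T (V n)" and one_V: "\<one> \<in> V n"
    and inv_V: "x \<in> V n \<Longrightarrow> inv x \<in> V n"
    and cube_V: "\<lbrakk>x \<in> V (Suc n); y \<in> V (Suc n); z \<in> V (Suc n)\<rbrakk> \<Longrightarrow> x \<otimes> y \<otimes> z \<in> V n"
    and conj_V: "x \<in> carrier G \<Longrightarrow> \<exists>m. \<forall>v\<in>V m. x \<otimes> v \<otimes> inv x \<in> V n"
    and convergent_V: "(\<And>n. s n \<in> V n) \<Longrightarrow>
        \<exists>l r. strict_mono (r :: nat \<Rightarrow> nat) \<and> limitin T (s \<circ> r) l sequentially"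
begin

section \<open>The intersection of the neighbourhoods as a closed, sequentially compact normal
  subgroup\<close>

definition core :: "'a set" where "core = (\<Inter>n. V n)"

lemma V_subset_carrier: "V n \<subseteq> carrier G"
  using open_V openin_subset topspace_eq_carrier by metis

lemma V_carrier: "x \<in> V n \<Longrightarrow> x \<in> carrier G"
  using V_subset_carrier by blast

lemma mult_V: "\<lbrakk>x \<in> V (Suc n); y \<in> V (Suc n)\<rbrakk> \<Longrightarrow> x \<otimes> y \<in> V n"
  using cube_V[of x n y \<one>] one_V V_carrier by simp

lemma V_mono: "m \<le> n \<Longrightarrow> V n \<subseteq> V m"
proof (induction rule: dec_induct)
  case (step k)
  have "V (Suc k) \<subseteq> V k" using mult_V[OF _ one_V] V_carrier by fastforce
  with step show ?case by blast
qed simp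

lemma core_subset_V: "core \<subseteq> V n"
  by (auto simp: core_def)

lemma core_subset_carrier: "core \<subseteq> carrier G"
  using core_subset_V V_subset_carrier by blast

lemma subgroup_core: "subgroup core G"
proof (rule subgroupI[OF core_subset_carrier])
  show "core \<noteq> {}" using one_V by (auto simp: core_def)
qed (auto simp: core_def inv_V mult_V)

lemma normal_core: "core \<lhd> G"
  unfolding normal_inv_iff
proof (intro conjI ballI subgroup_core)
  fix x h assume x: "x \<in> carrier G" and h: "h \<in> core"
  have "x \<otimes> h \<otimes> inv x \<in> V n" for n
    using conj_V[OF x, of n] h by (auto simp: core_def)
  then show "x \<otimes> h \<otimes> inv x \<in> core" by (simp add: core_def)
qed

lemma open_left_translate:
  "x \<in> carrier G \<Longrightarrow> openin T {y \<in> topspace T. inv x \<otimes> y \<in> V n}"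
  by (intro openin_continuous_map_preimage[OF continuous_map_left_mult] open_V) auto

lemma closure_of_meets_translate:
  assumes "x \<in> T closure_of S"
  obtains y where "y \<in> S" "y \<in> carrier G" "inv x \<otimes> y \<in> V n"
proof -
  have x: "x \<in> carrier G" using assms by (simp add: in_closure_of topspace_eq_carrier)
  then have "x \<in> {y \<in> topspace T. inv x \<otimes> y \<in> V n}" by (simp add: one_V topspace_eq_carrier)
  moreover have "\<exists>y. y \<in> S \<and> y \<in> U" if "x \<in> U" "openin T U" for U
    using assms that by (simp add: in_closure_of)
  ultimately obtain y where "y \<in> S" "y \<in> {y \<in> topspace T. inv x \<otimes> y \<in> V n}"
    using open_left_translate[OF x] by meson
  then show thesis using that by (simp add: topspace_eq_carrier)
qed

text \<open>A point \<open>x\<close> of the closure has a translate \<open>x V(n+1)\<close> meeting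
  \<open>V(n+1)\<close> in some \<open>y\<close>. By symmetry \<open>x\<close> is then a product of
  two elements of \<open>V(n+1)\<close>.\<close>

lemma closure_of_V: "T closure_of V (Suc n) \<subseteq> V n"
proof
  fix x assume x: "x \<in> T closure_of V (Suc n)"
  then obtain y where y: "y \<in> V (Suc n)" "y \<in> carrier G" "inv x \<otimes> y \<in> V (Suc n)"
    using closure_of_meets_translate by blast
  have "x \<in> carrier G" using x by (simp add: in_closure_of topspace_eq_carrier)
  then have "y \<otimes> inv (inv x \<otimes> y) = x"
    using y(2) by (simp add: inv_mult_group m_assoc[symmetric])
  then show "x \<in> V n" using mult_V[OF y(1) inv_V[OF y(3)]] by simp
qed

lemma closedin_core: "closedin T core"
proof -
  have "T closure_of core \<subseteq> core"
    using closure_of_mono[OF core_subset_V] closure_of_V unfolding core_def by blast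
  then show ?thesis
    using core_subset_carrier by (metis closure_of_subset_eq topspace_eq_carrier)
qed

lemma limit_in_core:
  assumes "\<And>n. \<forall>\<^sub>F k in sequentially. s k \<in> V n" "limitin T s l sequentially"
  shows "l \<in> core"
proof -
  have "l \<in> V n" for n
  proof -
    have "l \<in> T closure_of V (Suc n)"
      unfolding in_closure_of
    proof (intro conjI allI impI)
      show "l \<in> topspace T" using assms(2) by (simp add: limitin_def)
      fix U assume U: "l \<in> U \<and> openin T U"
      then have "\<forall>\<^sub>F k in sequentially. s k \<in> U" using assms(2) by (simp add: limitin_def)
      then have "\<forall>\<^sub>F k in sequentially. s k \<in> V (Suc n) \<and> s k \<in> U"
        using assms(1) eventually_conj by blast
      then show "\<exists>y. y \<in> V (Suc n) \<and> y \<in> U"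
        using eventually_happens trivial_limit_sequentially by blast
    qed
    then show ?thesis using closure_of_V by blast
  qed
  then show ?thesis by (simp add: core_def)
qed

text \<open>\<open>convergent_V\<close> needs the \<open>n\<close>-th term in \<open>V n\<close>, so
  the sequence is first thinned out; the limit lies in the core by
  \<open>limit_in_core\<close>.\<close>

lemma convergent_to_core:
  assumes s: "\<And>n. \<forall>\<^sub>F k in sequentially. s k \<in> V n"
  obtains l r where "l \<in> core" "strict_mono (r :: nat \<Rightarrow> nat)" "limitin T (s \<circ> r) l sequentially"
proof -
  obtain N where N: "\<And>n k. k \<ge> N n \<Longrightarrow> s k \<in> V n"
    using s unfolding eventually_sequentially by metis
  \<comment> \<open>The summand \<open>n\<close> makes \<open>q\<close> strictly increasing, and the
    sum makes it dominate \<open>N\<close>.\<close>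
  define q where "q n = n + (\<Sum>i\<le>n. N i)" for n
  have q: "strict_mono q" by (simp add: strict_mono_Suc_iff q_def)
  have "N n \<le> q n" for n
    using member_le_sum[of n "{..n}" N] by (simp add: q_def)
  then have "(s \<circ> q) n \<in> V n" for n using N by simp
  then obtain l r where lr: "strict_mono (r :: nat \<Rightarrow> nat)" "limitin T ((s \<circ> q) \<circ> r) l sequentially"
    using convergent_V by blast
  have qr: "strict_mono (q \<circ> r)" using q lr(1) by (rule strict_mono_o)
  have "l \<in> core"
  proof (rule limit_in_core[OF _ lr(2)])
    show "\<forall>\<^sub>F k in sequentially. (s \<circ> q \<circ> r) k \<in> V n" for n
      using eventually_subseq[OF qr s] by (simp add: o_def)
  qed
  then show thesis using that[of l "q \<circ> r"] qr lr(2) by (simp add: o_assoc)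
qed

lemma eventually_in_V:
  assumes "\<And>n. s n \<in> V n"
  shows "\<forall>\<^sub>F k in sequentially. s k \<in> V n"
  using eventually_ge_at_top[of n] by (rule eventually_mono) (use assms V_mono in blast)

lemma sequentially_compactin_core: "sequentially_compactin T core"
  unfolding sequentially_compactin_def sequentially_compact_space_def
proof (intro conjI allI impI)
  show "core \<subseteq> topspace T" using core_subset_carrier topspace_eq_carrier by simp
  fix s :: "nat \<Rightarrow> 'a" assume "\<forall>n. s n \<in> topspace (subtopology T core)"
  then have s: "s n \<in> core" for n by simp
  then have "\<forall>\<^sub>F k in sequentially. s k \<in> V n" for n using core_subset_V by (auto intro: always_eventually)
  then obtain l r where "l \<in> core" "strict_mono (r :: nat \<Rightarrow> nat)" "limitin T (s \<circ> r) l sequentially"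
    by (rule convergent_to_core)
  then show "\<exists>l r. strict_mono r \<and> limitin (subtopology T core) (s \<circ> r) l sequentially"
    using s by (auto simp: limitin_subtopology)
qed

text \<open>Otherwise points of \<open>V n\<close> outside \<open>U\<close> would have a subsequence
  converging to a point of the core, which lies in the open set \<open>U\<close>.\<close>

lemma V_subset_open:
  assumes "openin T U" "core \<subseteq> U"
  shows "\<exists>n. V n \<subseteq> U"
proof (rule ccontr)
  assume "\<nexists>n. V n \<subseteq> U"
  then have "\<forall>n. \<exists>x. x \<in> V n \<and> x \<notin> U" by blast
  then obtain s where s: "\<And>n. s n \<in> V n" "\<And>n. s n \<notin> U" by metis
  obtain l r where l: "l \<in> core" and "limitin T (s \<circ> r) l sequentially"
    using convergent_to_core[OF eventually_in_V[OF s(1)]] by blast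
  then have "\<forall>\<^sub>F k in sequentially. (s \<circ> r) k \<in> U" using assms by (auto simp: limitin_def)
  then show False using s(2) by simp
qed

lemma countable_character_core: "countable_character T core V"
  using open_V core_subset_V V_subset_open by (simp add: countable_character_def)

lemma strong_q_sequence_core: "y \<in> core \<Longrightarrow> strong_q_sequence T V y"
  using open_V core_subset_V convergent_V by (auto simp: strong_q_sequence_def)

text \<open>This is \<open>V_subset_open\<close> translated to \<open>x\<close>: an open set around
  a whole fibre of the quotient map contains some \<open>x V(n)\<close>.\<close>

lemma open_saturated:
  assumes "openin T U" "x \<in> carrier G" "x <# core \<subseteq> U"
  shows "\<exists>n. \<forall>y\<in>carrier G. inv x \<otimes> y \<in> V n \<longrightarrow> y \<in> U"
proof -
  have "openin T {v \<in> topspace T. x \<otimes> v \<in> U}"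
    using assms by (intro openin_continuous_map_preimage[OF continuous_map_left_mult])
  moreover have "core \<subseteq> {v \<in> topspace T. x \<otimes> v \<in> U}"
    using assms(3) core_subset_carrier by (auto simp: l_coset_def topspace_eq_carrier)
  ultimately obtain n where n: "V n \<subseteq> {v \<in> topspace T. x \<otimes> v \<in> U}" using V_subset_open by blast
  have "y \<in> U" if "y \<in> carrier G" "inv x \<otimes> y \<in> V n" for y
  proof -
    have "x \<otimes> (inv x \<otimes> y) \<in> U" using n that by blast
    then show ?thesis using assms(2) that by (simp add: m_assoc[symmetric])
  qed
  then show ?thesis by blast
qed

section \<open>The quotient mapping is closed and strongly sequential-perfect\<close>

abbreviation quot :: "'a \<Rightarrow> 'a set" where "quot \<equiv> coset_map G core"

lemma quotient_map_quot: "quotient_map T (coset_space G T core) quot"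
  by (simp add: coset_space_def quotient_map_quotient_topology)

lemma quot_eq_iff:
  "\<lbrakk>x \<in> carrier G; y \<in> carrier G\<rbrakk> \<Longrightarrow> quot x = quot y \<longleftrightarrow> inv x \<otimes> y \<in> core"
  by (rule subgroup_lcoset_eq_iff[OF subgroup_core])

lemma quot_mem: "\<lbrakk>x \<in> carrier G; y \<in> quot x\<rbrakk> \<Longrightarrow> y \<in> carrier G \<and> quot y = quot x"
  using l_repr_independence[OF _ _ subgroup_core] l_coset_carrier[OF _ _ subgroup_core] by blast

text \<open>New representatives contribute core factors on both sides,
  \<open>inv a \<otimes> x\<close> and \<open>inv y \<otimes> b\<close>, and the core lies in
  \<open>V (Suc n)\<close>. The cube condition absorbs them at the price of one index.\<close>

lemma close_representatives:
  assumes "x \<in> carrier G" "y \<in> carrier G" "inv x \<otimes> y \<in> V (Suc n)" "a \<in> quot x" "b \<in> quot y"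
  shows "inv a \<otimes> b \<in> V n"
proof -
  have ab: "a \<in> carrier G" "b \<in> carrier G" "quot a = quot x" "quot y = quot b"
    using quot_mem[OF assms(1,4)] quot_mem[OF assms(2,5)] by auto
  then have "inv a \<otimes> x \<in> core" "inv y \<otimes> b \<in> core" using quot_eq_iff assms by auto
  then have "(inv a \<otimes> x) \<otimes> (inv x \<otimes> y) \<otimes> (inv y \<otimes> b) \<in> V n"
    using cube_V assms core_subset_V by blast
  moreover have "(inv a \<otimes> x) \<otimes> (inv x \<otimes> y) \<otimes> (inv y \<otimes> b) = inv a \<otimes> b"
    using assms(1,2) ab(1,2) by (simp add: mult_cancel_middle)
  ultimately show ?thesis by simp
qed

text \<open>The saturation \<open>?E\<close> of \<open>F\<close> has to be closed. If the fibre of a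
  closure point \<open>x\<close> missed \<open>F\<close>, some \<open>x V(n)\<close> would miss
  \<open>F\<close>; but a point of \<open>?E\<close> in \<open>x V(n+1)\<close> shares its coset
  with a point of \<open>F\<close>, which then lies in \<open>x V(n)\<close>.\<close>

lemma closed_map_quot: "closed_map T (coset_space G T core) quot"
  unfolding closed_map_def
proof (intro allI impI)
  fix F assume F: "closedin T F"
  then have Fc: "F \<subseteq> carrier G" using closedin_subset topspace_eq_carrier by blast
  let ?E = "{x \<in> topspace T. quot x \<in> quot ` F}"
  have "x \<in> ?E" if x: "x \<in> T closure_of ?E" for x
  proof (rule ccontr)
    assume "x \<notin> ?E"
    have xc: "x \<in> carrier G" using x by (simp add: in_closure_of topspace_eq_carrier)
    have "y \<in> topspace T - F" if "y \<in> quot x" for y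
    proof -
      have "y \<in> carrier G" "quot y = quot x" using quot_mem[OF xc that] by auto
      moreover have "quot x \<notin> quot ` F" using \<open>x \<notin> ?E\<close> xc topspace_eq_carrier by blast
      ultimately show ?thesis using topspace_eq_carrier by (metis DiffI image_eqI)
    qed
    then have "quot x \<subseteq> topspace T - F" by blast
    then obtain n where n: "\<And>y. \<lbrakk>y \<in> carrier G; inv x \<otimes> y \<in> V n\<rbrakk> \<Longrightarrow> y \<notin> F"
      using open_saturated[OF openin_diff[OF openin_topspace F] xc] by (meson DiffD2)
    obtain y where y: "y \<in> ?E" "y \<in> carrier G" "inv x \<otimes> y \<in> V (Suc n)"
      by (rule closure_of_meets_translate[OF x])
    then obtain f where f: "f \<in> F" "quot y = quot f" by blast
    then have "f \<in> quot y" using lcos_self subgroup_core Fc by blast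
    then have "inv x \<otimes> f \<in> V n"
      using close_representatives[OF xc y(2,3)] lcos_self[OF xc subgroup_core] by blast
    then show False using n f Fc by blast
  qed
  then have "T closure_of ?E \<subseteq> ?E" by blast
  then have "closedin T ?E" using closure_of_subset_eq[of ?E T] by blast
  moreover have "quot ` F \<subseteq> topspace (coset_space G T core)"
    using Fc by (auto simp: coset_space_def topspace_eq_carrier)
  ultimately show "closedin (coset_space G T core) (quot ` F)"
    using quotient_map_quot by (simp add: quotient_map_closedin)
qed

text \<open>The witness is the image of \<open>x V(n+1)\<close>. It is open because its preimage is
  a union of right translates by core elements, and \<open>close_representatives\<close> controls
  every representative.\<close>

lemma open_quotient_image:
  assumes x: "x \<in> carrier G"
  shows "\<exists>U. openin (coset_space G T core) U \<and> quot x \<in> U \<and>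
    (\<forall>y\<in>carrier G. quot y \<in> U \<longrightarrow> inv x \<otimes> y \<in> V n)"
proof -
  let ?A = "{y \<in> topspace T. inv x \<otimes> y \<in> V (Suc n)}"
  have A: "openin T ?A" "x \<in> ?A"
    using open_left_translate[OF x] x one_V by (auto simp: topspace_eq_carrier)
  have eq: "quot y \<in> quot ` ?A \<longleftrightarrow> (\<exists>h\<in>core. y \<otimes> h \<in> ?A)" if y: "y \<in> carrier G" for y
  proof
    assume "quot y \<in> quot ` ?A"
    then obtain a where a: "a \<in> ?A" "quot y = quot a" by blast
    then have "inv y \<otimes> a \<in> core" using quot_eq_iff y topspace_eq_carrier by auto
    moreover have "y \<otimes> (inv y \<otimes> a) = a"
      using a y topspace_eq_carrier by (simp add: m_assoc[symmetric])
    ultimately show "\<exists>h\<in>core. y \<otimes> h \<in> ?A" using a by metis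
  next
    assume "\<exists>h\<in>core. y \<otimes> h \<in> ?A"
    then obtain h where h: "h \<in> core" "y \<otimes> h \<in> ?A" by blast
    then have "y \<otimes> h \<in> quot y" by (auto simp: l_coset_def)
    then have "quot y = quot (y \<otimes> h)" using quot_mem[OF y] by simp
    then show "quot y \<in> quot ` ?A" using h by blast
  qed
  have "{y \<in> topspace T. quot y \<in> quot ` ?A} = {y \<in> topspace T. \<exists>h\<in>core. y \<otimes> h \<in> ?A}"
    by (intro Collect_cong conj_cong refl eq) (simp add: topspace_eq_carrier)
  then have "{y \<in> topspace T. quot y \<in> quot ` ?A} =
      (\<Union>h\<in>core. {y \<in> topspace T. y \<otimes> h \<in> ?A})"
    by blast
  moreover have "openin T {y \<in> topspace T. y \<otimes> h \<in> ?A}" if "h \<in> core" for h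
    by (intro openin_continuous_map_preimage[OF continuous_map_mult A(1)])
      (use that core_subset_carrier in \<open>auto simp: topspace_eq_carrier\<close>)
  ultimately have "openin T {y \<in> topspace T. quot y \<in> quot ` ?A}" by auto
  then have "openin (coset_space G T core) (quot ` ?A)"
    by (auto simp: coset_space_def openin_quotient_topology)
  moreover have "inv x \<otimes> y \<in> V n" if y: "y \<in> carrier G" "quot y \<in> quot ` ?A" for y
  proof -
    obtain a where a: "a \<in> ?A" "quot y = quot a" using y by blast
    then have "y \<in> quot a" using lcos_self[OF y(1) subgroup_core] by simp
    then show ?thesis
      using close_representatives[of x a n x y] a x lcos_self[OF x subgroup_core]
      by (simp add: topspace_eq_carrier)
  qed
  ultimately show ?thesis using A(2) by blast
qed

text \<open>If the images converge along a subsequence to the coset of \<open>z\<close>, then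
  translating that subsequence by \<open>inv z\<close> brings it eventually into every
  \<open>V n\<close>. A further subsequence converges to a core point by
  \<open>convergent_to_core\<close>, and translating back gives a limit in the fibre of
  \<open>z\<close>.\<close>

lemma sequentially_compactin_quot_preimage:
  assumes K: "sequentially_compactin (coset_space G T core) K"
  shows "sequentially_compactin T {x \<in> topspace T. quot x \<in> K}" (is "sequentially_compactin T ?P")
  unfolding sequentially_compactin_def sequentially_compact_space_def
proof (intro conjI allI impI)
  fix s :: "nat \<Rightarrow> 'a" assume "\<forall>n. s n \<in> topspace (subtopology T ?P)"
  then have s: "s n \<in> carrier G" "quot (s n) \<in> K" for n by (auto simp: topspace_eq_carrier)
  have "(quot \<circ> s) n \<in> topspace (subtopology (coset_space G T core) K)" for n
    using s by (auto simp: coset_space_def topspace_eq_carrier)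
  then obtain L r where r: "strict_mono (r :: nat \<Rightarrow> nat)"
      and "limitin (subtopology (coset_space G T core) K) (quot \<circ> s \<circ> r) L sequentially"
    using K unfolding sequentially_compactin_def sequentially_compact_space_def by metis
  then have L: "L \<in> K" "limitin (coset_space G T core) (quot \<circ> s \<circ> r) L sequentially"
    by (auto simp: limitin_subtopology)
  then have "L \<in> topspace (coset_space G T core)" by (simp add: limitin_def)
  then obtain z where z: "z \<in> carrier G" "L = quot z"
    by (auto simp: coset_space_def topspace_eq_carrier)
  have "\<forall>\<^sub>F k in sequentially. inv z \<otimes> s (r k) \<in> V n" for n
  proof -
    obtain U where U: "openin (coset_space G T core) U" "quot z \<in> U"
        "\<And>y. \<lbrakk>y \<in> carrier G; quot y \<in> U\<rbrakk> \<Longrightarrow> inv z \<otimes> y \<in> V n"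
      using open_quotient_image[OF z(1)] by meson
    have "\<forall>\<^sub>F k in sequentially. (quot \<circ> s \<circ> r) k \<in> U"
      using L(2) U z by (simp add: limitin_def)
    then show ?thesis by (rule eventually_mono) (use U(3) s in simp)
  qed
  then obtain l q where lq: "l \<in> core" "strict_mono (q :: nat \<Rightarrow> nat)"
      "limitin T ((\<lambda>k. inv z \<otimes> s (r k)) \<circ> q) l sequentially"
    by (rule convergent_to_core)
  have "limitin T ((\<lambda>y. z \<otimes> y) \<circ> ((\<lambda>k. inv z \<otimes> s (r k)) \<circ> q)) (z \<otimes> l) sequentially"
    using continuous_map_limit[OF continuous_map_left_mult[OF z(1)] lq(3)] .
  moreover have "(\<lambda>y. z \<otimes> y) \<circ> ((\<lambda>k. inv z \<otimes> s (r k)) \<circ> q) = s \<circ> (r \<circ> q)"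
    using s z by (auto simp: fun_eq_iff m_assoc[symmetric])
  ultimately have lim: "limitin T (s \<circ> (r \<circ> q)) (z \<otimes> l) sequentially" by simp
  have "z \<otimes> l \<in> quot z" using lq(1) by (auto simp: l_coset_def)
  then have "z \<otimes> l \<in> ?P" using quot_mem[OF z(1)] L(1) z by (simp add: topspace_eq_carrier)
  then have "limitin (subtopology T ?P) (s \<circ> (r \<circ> q)) (z \<otimes> l) sequentially"
    using lim s by (auto simp: limitin_subtopology topspace_eq_carrier)
  then show "\<exists>l r. strict_mono r \<and> limitin (subtopology T ?P) (s \<circ> r) l sequentially"
    using strict_mono_o[OF r lq(2)] by blast
qed auto

lemma strongly_sequential_perfect_map_quot:
  "strongly_sequential_perfect_map T (coset_space G T core) quot"
  using quotient_imp_continuous_map[OF quotient_map_quot] closed_map_quot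
    sequentially_compactin_quot_preimage
  by (simp add: strongly_sequential_perfect_map_def)

section \<open>Metrizability of the quotient\<close>

lemma coset_space_cases:
  assumes "A \<in> topspace (coset_space G T core)"
  obtains x where "x \<in> carrier G" "A = quot x" "x \<in> A"
  using assms lcos_self[OF _ subgroup_core] by (auto simp: coset_space_def topspace_eq_carrier)

lemma coset_space_carrier:
  "\<lbrakk>A \<in> topspace (coset_space G T core); a \<in> A\<rbrakk> \<Longrightarrow> a \<in> carrier G"
  by (erule coset_space_cases) (auto dest: quot_mem)

text \<open>Quantifying over all representatives avoids choosing any. By \<open>near_quot\<close>
  one pair of representatives suffices, with a loss of one index.\<close>

definition near :: "nat \<Rightarrow> 'a set \<Rightarrow> 'a set \<Rightarrow> bool" where
  "near n A B \<longleftrightarrow> (\<forall>a\<in>A. \<forall>b\<in>B. inv a \<otimes> b \<in> V n)"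

lemma nearD: "\<lbrakk>near n A B; a \<in> A; b \<in> B\<rbrakk> \<Longrightarrow> inv a \<otimes> b \<in> V n"
  by (simp add: near_def)

lemma near_quot:
  "\<lbrakk>x \<in> carrier G; y \<in> carrier G; inv x \<otimes> y \<in> V (Suc n)\<rbrakk> \<Longrightarrow> near n (quot x) (quot y)"
  unfolding near_def by (intro ballI) (rule close_representatives)

text \<open>Arbitrary representatives of the two middle cosets make the product of the three
  differences telescope, so \<open>cube_V\<close> applies.\<close>

lemma near_chain3:
  assumes "A \<in> topspace (coset_space G T core)" "B \<in> topspace (coset_space G T core)"
    "C \<in> topspace (coset_space G T core)" "D \<in> topspace (coset_space G T core)"
    and R: "near (Suc n) A B" "near (Suc n) B C" "near (Suc n) C D"
  shows "near n A D"
  unfolding near_def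
proof (intro ballI)
  fix a d assume ad: "a \<in> A" "d \<in> D"
  obtain b where b: "b \<in> carrier G" "b \<in> B" by (rule coset_space_cases[OF assms(2)])
  obtain c where c: "c \<in> carrier G" "c \<in> C" by (rule coset_space_cases[OF assms(3)])
  have "(inv a \<otimes> b) \<otimes> (inv b \<otimes> c) \<otimes> (inv c \<otimes> d) \<in> V n"
    using nearD[OF R(1) ad(1) b(2)] nearD[OF R(2) b(2) c(2)] nearD[OF R(3) c(2) ad(2)]
    by (rule cube_V)
  moreover have "(inv a \<otimes> b) \<otimes> (inv b \<otimes> c) \<otimes> (inv c \<otimes> d) = inv a \<otimes> d"
    using b c coset_space_carrier[OF assms(1) ad(1)] coset_space_carrier[OF assms(4) ad(2)]
    by (simp add: mult_cancel_middle)
  ultimately show "inv a \<otimes> d \<in> V n" by simp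
qed

text \<open>From left to right, \<open>open_saturated\<close> is applied to the open preimage of
  \<open>U\<close>. Conversely, \<open>open_quotient_image\<close> supplies an open set around each
  coset in which all cosets are near it.\<close>

lemma openin_coset_space_iff_near:
  assumes U: "U \<subseteq> topspace (coset_space G T core)"
  shows "openin (coset_space G T core) U \<longleftrightarrow>
    (\<forall>A\<in>U. \<exists>n. \<forall>B\<in>topspace (coset_space G T core). near n A B \<longrightarrow> B \<in> U)"
    (is "openin ?X U \<longleftrightarrow> ?R")
proof
  assume "openin ?X U"
  then have P: "openin T {x \<in> topspace T. quot x \<in> U}" (is "openin T ?P")
    by (simp add: coset_space_def openin_quotient_topology)
  show ?R
  proof
    fix A assume A: "A \<in> U"
    obtain x where x: "x \<in> carrier G" "A = quot x" "x \<in> A"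
      by (rule coset_space_cases[OF subsetD[OF U A]])
    have "y \<in> ?P" if "y \<in> quot x" for y
      using quot_mem[OF x(1) that] A x(2) by (simp add: topspace_eq_carrier)
    then have "quot x \<subseteq> ?P" by blast
    then obtain n where n: "\<forall>y\<in>carrier G. inv x \<otimes> y \<in> V n \<longrightarrow> y \<in> ?P"
      using open_saturated[OF P x(1)] by meson
    have "B \<in> U" if B: "B \<in> topspace ?X" and AB: "near n A B" for B
    proof -
      obtain y where y: "y \<in> carrier G" "B = quot y" "y \<in> B" by (rule coset_space_cases[OF B])
      have "y \<in> ?P" using n y(1) nearD[OF AB x(3) y(3)] by simp
      then show ?thesis using y(2) by simp
    qed
    then show "\<exists>n. \<forall>B\<in>topspace ?X. near n A B \<longrightarrow> B \<in> U" by blast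
  qed
next
  assume R: ?R
  have "\<exists>W. openin ?X W \<and> A \<in> W \<and> W \<subseteq> U" if A: "A \<in> U" for A
  proof -
    obtain x where x: "x \<in> carrier G" "A = quot x" "x \<in> A"
      by (rule coset_space_cases[OF subsetD[OF U A]])
    obtain n where n: "\<And>B. \<lbrakk>B \<in> topspace ?X; near n A B\<rbrakk> \<Longrightarrow> B \<in> U"
      using bspec[OF R A] by blast
    obtain W where W: "openin ?X W" "quot x \<in> W"
        "\<And>y. \<lbrakk>y \<in> carrier G; quot y \<in> W\<rbrakk> \<Longrightarrow> inv x \<otimes> y \<in> V (Suc n)"
      using open_quotient_image[OF x(1)] by meson
    have "B \<in> U" if B: "B \<in> W" for B
    proof -
      have BX: "B \<in> topspace ?X" using openin_subset[OF W(1)] B by blast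
      obtain y where y: "y \<in> carrier G" "B = quot y" "y \<in> B" by (rule coset_space_cases[OF BX])
      then have "near n A B" using near_quot[OF x(1) y(1) W(3)] B x(2) by simp
      then show ?thesis by (rule n[OF BX])
    qed
    then show ?thesis using W x by blast
  qed
  then show "openin ?X U" using openin_subopen[of ?X U] by blast
qed

lemma metrizable_coset_space: "metrizable_space (coset_space G T core)"
proof (rule metrizable_space_from_relations[where R = near])
  let ?X = "coset_space G T core"
  show "near n A A" if A: "A \<in> topspace ?X" for A n
  proof -
    obtain x where "x \<in> carrier G" "A = quot x" by (rule coset_space_cases[OF A])
    then show ?thesis using near_quot[of x x n] one_V by simp
  qed
  show "near n B A" if A: "A \<in> topspace ?X" and B: "B \<in> topspace ?X" and AB: "near n A B" for A B n
    unfolding near_def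
  proof (intro ballI)
    fix a b assume ab: "b \<in> B" "a \<in> A"
    have "inv (inv a \<otimes> b) = inv b \<otimes> a"
      using coset_space_carrier[OF A ab(2)] coset_space_carrier[OF B ab(1)]
      by (simp add: inv_mult_group)
    then show "inv b \<otimes> a \<in> V n" using inv_V[OF nearD[OF AB ab(2,1)]] by simp
  qed
  show "A = B" if A: "A \<in> topspace ?X" and B: "B \<in> topspace ?X" and AB: "\<And>n. near n A B" for A B
  proof -
    obtain x where x: "x \<in> carrier G" "A = quot x" "x \<in> A" by (rule coset_space_cases[OF A])
    obtain y where y: "y \<in> carrier G" "B = quot y" "y \<in> B" by (rule coset_space_cases[OF B])
    \<comment> \<open>Cosets near at every level differ by an element of all \<open>V n\<close>,
      that is, of the core.\<close>
    have "inv x \<otimes> y \<in> core" using nearD[OF AB x(3) y(3)] by (simp add: core_def)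
    then show ?thesis using quot_eq_iff[OF x(1) y(1)] x y by simp
  qed
  show "near n A D"
    if "A \<in> topspace ?X" "B \<in> topspace ?X" "C \<in> topspace ?X" "D \<in> topspace ?X"
      "near (Suc n) A B" "near (Suc n) B C" "near (Suc n) C D" for A B C D n
    using that by (rule near_chain3)
  show "openin ?X U \<longleftrightarrow> (\<forall>A\<in>U. \<exists>n. \<forall>B\<in>topspace ?X. near n A B \<longrightarrow> B \<in> U)"
    if "U \<subseteq> topspace ?X" for U
    using that by (rule openin_coset_space_iff_near)
qed

end

section \<open>Construction of the absorbing sequence\<close>

text \<open>Each chosen neighbourhood brings countably many further ones by balancedness, and all of
  these must eventually be refined. Stage \<open>n\<close> deals only with the pairs of indices
  below \<open>n\<close>, so finite intersections suffice.\<close>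

lemma (in topological_group) exists_absorbing_q_sequence:
  assumes bal: "omega_balanced G T" and q: "strong_q_sequence T U \<one>"
    and W: "openin T W" "\<one> \<in> W"
  obtains V where "absorbing_q_sequence G T V" "\<And>n. V n \<subseteq> W"
proof -
  have U: "openin T (U n)" "\<one> \<in> U n" for n using q by (auto simp: strong_q_sequence_def)
  define A where "A B g \<longleftrightarrow> (\<forall>n. openin T (g n) \<and> \<one> \<in> g n) \<and>
      (\<forall>x\<in>carrier G. \<exists>n. \<forall>v\<in>g n. x \<otimes> v \<otimes> inv x \<in> B)" for B and g :: "nat \<Rightarrow> 'a set"
  have "\<exists>g. A B g" if B: "openin T B" "\<one> \<in> B" for B
  proof -
    obtain g :: "nat \<Rightarrow> 'a set" where "\<And>n. openin T (g n)" "\<And>n. \<one> \<in> g n"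
      "\<And>x. x \<in> carrier G \<Longrightarrow> \<exists>n. \<forall>v\<in>g n. x \<otimes> v \<otimes> inv x \<in> B"
      using omega_balancedD[OF bal B] by metis
    then have "A B g" by (simp add: A_def)
    then show ?thesis by blast
  qed
  \<comment> \<open>The witnessing sequence is fixed once for each neighbourhood \<open>B\<close>,
    so that the recursion can refer to it at later stages.\<close>
  then obtain g where gA: "\<And>B. \<lbrakk>openin T B; \<one> \<in> B\<rbrakk> \<Longrightarrow> A B (g B)" by metis
  have g: "openin T (g B n)" "\<one> \<in> g B n"
      "x \<in> carrier G \<Longrightarrow> \<exists>n. \<forall>v\<in>g B n. x \<otimes> v \<otimes> inv x \<in> B"
    if "openin T B" "\<one> \<in> B" for B n x
    using gA[OF that] by (simp_all add: A_def)
  \<comment> \<open>\<open>f\<close> holds the earlier stages. The conditions on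
    \<open>g (f i) j\<close> with \<open>i, j < n\<close> are the diagonal bookkeeping for
    conjugation.\<close>
  define P where "P f n C \<longleftrightarrow> openin T C \<and> \<one> \<in> C \<and> (\<forall>x\<in>C. inv x \<in> C) \<and> C \<subseteq> U n \<inter> W \<and>
      (\<forall>i<n. (\<forall>x\<in>C. \<forall>y\<in>C. \<forall>z\<in>C. x \<otimes> y \<otimes> z \<in> f i) \<and> (\<forall>j<n. C \<subseteq> g (f i) j))"
    for f :: "nat \<Rightarrow> 'a set" and n :: nat and C
  have "\<exists>V. \<forall>n. P V n (V n)"
  proof (rule dependent_wellorder_choice)
    show "P f n C = P f' n C" if "\<And>k. k < n \<Longrightarrow> f k = f' k" for f f' n C
      using that unfolding P_def by simp
    fix n f assume "\<And>k. k < n \<Longrightarrow> P f k (f k)"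
    then have f: "openin T (f i)" "\<one> \<in> f i" if i: "i < n" for i
      using i unfolding P_def by blast+
    \<comment> \<open>A symmetric cube root of \<open>D\<close> meets all demands of stage
      \<open>n\<close>: its cubes lie in each \<open>f i\<close>, and it lies in \<open>D\<close>
      itself because it contains the identity.\<close>
    define D where "D = \<Inter>(insert (U n \<inter> W) ((\<lambda>i. \<Inter>(insert (f i) (g (f i) ` {..<n}))) ` {..<n}))"
    have one: "\<one> \<in> D" using U W f g(2)[OF f] by (simp add: D_def)
    have "openin T (\<Inter>(insert (f i) (g (f i) ` {..<n})))" if i: "i < n" for i
      by (rule openin_Inter) (use f[OF i] g(1)[OF f[OF i]] in auto)
    then have "openin T D" unfolding D_def
      by (intro openin_Inter) (use U W in auto)
    then obtain C where C: "openin T C" "\<one> \<in> C" "\<And>x. x \<in> C \<Longrightarrow> inv x \<in> C"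
        "\<And>x y z. \<lbrakk>x \<in> C; y \<in> C; z \<in> C\<rbrakk> \<Longrightarrow> x \<otimes> y \<otimes> z \<in> D"
      using open_symmetric_cube_root[OF _ one] by metis
    have "C \<subseteq> D"
    proof
      fix x assume "x \<in> C"
      then have "x \<otimes> \<one> \<otimes> \<one> \<in> D" using C by blast
      moreover have "x \<in> carrier G"
        using \<open>x \<in> C\<close> C(1) openin_subset topspace_eq_carrier by blast
      ultimately show "x \<in> D" by simp
    qed
    then have "P f n C" unfolding P_def using C by (auto simp: D_def subset_iff)
    then show "\<exists>C. P f n C" ..
  qed
  then obtain V where V: "\<And>n. P V n (V n)" by blast
  have V_open: "openin T (V n)" "\<one> \<in> V n" for n using V[of n] by (auto simp: P_def)
  have V_sub: "V n \<subseteq> U n \<inter> W" for n using V[of n] by (auto simp: P_def)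
  have "absorbing_q_sequence G T V"
  proof (unfold_locales)
    show "openin T (V n)" "\<one> \<in> V n" for n by (fact V_open)+
    show "inv x \<in> V n" if "x \<in> V n" for x n using V[of n] that by (auto simp: P_def)
    show "x \<otimes> y \<otimes> z \<in> V n" if "x \<in> V (Suc n)" "y \<in> V (Suc n)" "z \<in> V (Suc n)" for x y z n
      using V[of "Suc n"] that by (auto simp: P_def)
    show "\<exists>m. \<forall>v\<in>V m. x \<otimes> v \<otimes> inv x \<in> V n" if x: "x \<in> carrier G" for x n
    proof -
      obtain j where j: "\<forall>v\<in>g (V n) j. x \<otimes> v \<otimes> inv x \<in> V n" using g(3)[OF V_open x] by blast
      \<comment> \<open>The index exceeds both \<open>n\<close> and \<open>j\<close>, so the pair
        has been treated by that stage.\<close>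
      have "V (Suc (max n j)) \<subseteq> g (V n) j"
        using V[of "Suc (max n j)"] by (simp add: P_def less_Suc_eq_le)
      then show ?thesis using j by blast
    qed
    show "\<exists>l r. strict_mono (r :: nat \<Rightarrow> nat) \<and> limitin T (s \<circ> r) l sequentially"
      if "\<And>n. s n \<in> V n" for s
    proof -
      have "\<forall>n. s n \<in> U n" using V_sub that by blast
      then show ?thesis using q unfolding strong_q_sequence_def by blast
    qed
  qed
  then show thesis by (rule that) (use V_sub in blast)
qed

section \<open>The converse direction and the equivalence\<close>

text \<open>For each \<open>x\<close>, normality puts \<open>H\<close> inside the preimage of the
  interior of \<open>U\<close> under conjugation by \<open>x\<close>. Countable character then gives
  a member of \<open>V\<close> inside that preimage, so the single countable family
  \<open>range V\<close> serves all \<open>x\<close>.\<close>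

lemma (in topological_group) omega_balanced_if_normal_countable_character:
  assumes "\<And>W. \<lbrakk>openin T W; \<one> \<in> W\<rbrakk> \<Longrightarrow> \<exists>H V. H \<lhd> G \<and> countable_character T H V \<and> H \<subseteq> W"
  shows "omega_balanced G T"
  unfolding omega_balanced_def
proof (intro allI impI)
  fix U assume U: "U \<subseteq> topspace T" "\<one> \<in> T interior_of U"
  obtain H V where H: "H \<lhd> G" "countable_character T H V" "H \<subseteq> T interior_of U"
    using assms[OF _ U(2)] by auto
  have VH: "openin T (V n)" "H \<subseteq> V n" for n using H(2) by (auto simp: countable_character_def)
  have sub: "subgroup H G" and conj: "\<And>x h. \<lbrakk>x \<in> carrier G; h \<in> H\<rbrakk> \<Longrightarrow> x \<otimes> h \<otimes> inv x \<in> H"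
    using H(1) by (auto simp: normal_inv_iff)
  have "\<exists>n. (\<lambda>v. x \<otimes> v \<otimes> inv x) ` V n \<subseteq> U" if x: "x \<in> carrier G" for x
  proof -
    let ?A = "{v \<in> topspace T. x \<otimes> v \<otimes> inv x \<in> T interior_of U}"
    have "openin T ?A"
      by (intro openin_continuous_map_preimage[OF continuous_map_conj[OF x]]) simp
    moreover have "H \<subseteq> ?A"
      using conj[OF x] H(3) subgroup.subset[OF sub] topspace_eq_carrier by auto
    ultimately obtain n where "V n \<subseteq> ?A" using H(2) unfolding countable_character_def by blast
    then show ?thesis using interior_of_subset[of T U] by blast
  qed
  then show "\<exists>\<gamma>. countable \<gamma> \<and> (\<forall>V\<in>\<gamma>. openin T V \<and> \<one> \<in> V) \<and>
      (\<forall>x\<in>carrier G. \<exists>V\<in>\<gamma>. (\<lambda>v. x \<otimes> v \<otimes> inv x) ` V \<subseteq> U)"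
    using VH(1) subsetD[OF VH(2) subgroup.one_closed[OF sub]] by (intro exI[of _ "range V"]) auto
qed

theorem theorem2p10:
  fixes G :: "('a, 'b) monoid_scheme" and T :: "'a topology"
  assumes "topological_group G T" and "Hausdorff_space T"
  shows "(omega_balanced G T \<and> strong_q_space T) \<longleftrightarrow>
    (\<forall>W. openin T W \<and> \<one>\<^bsub>G\<^esub> \<in> W \<longrightarrow>
      (\<exists>H V. H \<lhd> G \<and> closedin T H \<and> sequentially_compactin T H \<and>
        countable_character T H V \<and>
        H \<subseteq> W \<and>
        (\<forall>y\<in>H. strong_q_sequence T V y) \<and>
        strongly_sequential_perfect_map T (coset_space G T H) (coset_map G H) \<and>
        metrizable_space (coset_space G T H)))"
    (is "?L \<longleftrightarrow> (\<forall>W. ?nbhd W \<longrightarrow> (\<exists>H V. ?R W H V))")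
proof
  interpret topological_group G T by fact
  assume L: ?L
  then obtain U where U: "strong_q_sequence T U \<one>\<^bsub>G\<^esub>"
    by (auto simp: strong_q_space_def strong_q_point_def topspace_eq_carrier)
  show "\<forall>W. ?nbhd W \<longrightarrow> (\<exists>H V. ?R W H V)"
  proof (intro allI impI)
    fix W assume "?nbhd W"
    then obtain V where "absorbing_q_sequence G T V" and VW: "\<And>n. V n \<subseteq> W"
      using exists_absorbing_q_sequence[OF _ U] L by blast
    then interpret absorbing_q_sequence G T V by simp
    have "?R W core V"
      using normal_core closedin_core sequentially_compactin_core countable_character_core
        strong_q_sequence_core strongly_sequential_perfect_map_quot metrizable_coset_space
        order_trans[OF core_subset_V VW] by blast
    then show "\<exists>H V. ?R W H V" by blast
  qed
next
  interpret topological_group G T by fact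
  assume R: "\<forall>W. ?nbhd W \<longrightarrow> (\<exists>H V. ?R W H V)"
  have "omega_balanced G T"
    by (rule omega_balanced_if_normal_countable_character) (use R in blast)
  moreover have "strong_q_space T"
  proof -
    \<comment> \<open>Any neighbourhood would do, since only a strong q-sequence at the identity is
      extracted before translating.\<close>
    have "?nbhd (topspace T)" using openin_topspace one_closed topspace_eq_carrier by metis
    then obtain H V where "H \<lhd> G" "\<forall>y\<in>H. strong_q_sequence T V y" using R by blast
    then have "strong_q_sequence T V \<one>\<^bsub>G\<^esub>"
      using subgroup.one_closed normal_imp_subgroup by blast
    then show ?thesis
      using strong_q_sequence_left_translate topspace_eq_carrier
      unfolding strong_q_space_def strong_q_point_def by blast
  qed
  ultimately show ?L by blast
qed

end
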